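(* Let $\beta,\mu>0$ and let $n_s,n_t\in\mathbb N$ with $n_s\ge n_t$. Set $h_s=\beta/n_s$, $h_t=2\mu/n_t$, and define $s_i=h_s i$ for $i=0,\ldots,n_s$ and $t_j=-\mu+h_t j$ for $j=0,\ldots,n_t$. Let $\boldsymbol R\in\mathbb R^{(n_s+1)\times(n_t+1)}$ be the matrix with entries $R_{i,j}=\exp(-s_it_j)$, and set $q=\left\lfloor\frac{n_s+1}{n_t+1}\right\rfloor$. If $$1\le n_t+1\le\frac{\beta\mu}{2e},$$ then $$\kappa(\boldsymbol R)\le\sqrt2\,(n_t+1)\exp(3\beta\mu)\left(1+\frac1q\right)^{n_t+1/2}.$$
   Context: $\mathbb N$ denotes the positive integers. For a real rectangular matrix $\boldsymbol R$ with at least as many rows as columns, $\kappa(\boldsymbol R)$ is the spectral-norm condition number $\kappa(\boldsymbol R)=\sqrt{\lambda_{\max}(\boldsymbol R^\top\boldsymbol R)/\lambda_{\min}(\boldsymbol R^\top\boldsymbol R)}$, i.e. the ratio of the largest to the smallest singular value. $e$ is Euler's number. *)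

theory Defs
  imports "Jordan_Normal_Form.Spectral_Radius" "HOL-Library.Extended_Real"
begin

definition lambda_max :: "real mat \<Rightarrow> real" where
  "lambda_max A = Max (spectrum A)"

definition lambda_min :: "real mat \<Rightarrow> real" where
  "lambda_min A = Min (spectrum A)"

(* Intended for dim_col R \<le> dim_row R, dim_col R > 0; then transpose_mat R * R is symmetric
   and its real spectrum is finite and nonempty. The value is infinite on rank-deficient matrices,
   since division by zero in the reals would give 0 there. *)
definition cond_number :: "real mat \<Rightarrow> ereal" where
  "cond_number R =
     (let G = transpose_mat R * R
      in if lambda_min G = 0 then \<infinity> else ereal (sqrt (lambda_max G / lambda_min G)))"

end

theory Submission
  imports Defs "HOL-Analysis.L2_Norm"
begin

text \<open>Put \<open>n = n\<^sub>t\<close>, \<open>B = \<beta>\<mu>\<close> and keep only the rows \<open>k + q l\<close> with \<open>l \<le> n\<close>, for a fixed \<open>k < q\<close>.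
  Up to row and column scalings these rows form a square Vandermonde matrix with nodes
  \<open>exp (- a l)\<close>, where \<open>a = 2 B q / (n\<^sub>s n)\<close>. Lagrange interpolation, together with the \<open>\<ell>\<^sup>1\<close> norm of the
  coefficients of the Lagrange polynomials, bounds \<open>\<bar>v\<bar>\<close> by \<open>e\<^sup>2\<^sup>B (1 + 1/q)\<^sup>n\<close> times the norm of
  those \<open>n + 1\<close> entries of \<open>R v\<close>; this uses \<open>n\<^sup>n / n! \<le> e\<^sup>n\<close> and \<open>B \<ge> 2 e (n + 1)\<close>.
  The \<open>q\<close> residue classes are disjoint, so adding them up gains a factor \<open>q\<close> in the lower bound for
  the eigenvalues of \<open>R\<^sup>T R\<close>, while Cauchy-Schwarz gives the upper bound
  \<open>(n\<^sub>s + 1) (n + 1) e\<^sup>2\<^sup>B\<close>; finally \<open>n\<^sub>s + 1 \<le> (q + 1) (n + 1)\<close>.\<close>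

section \<open>Elementary inequalities and factorial products\<close>

lemma power_divide_fact_le_exp:
  fixes x :: real
  assumes "x \<ge> 0"
  shows "x ^ n / fact n \<le> exp x"
proof -
  have s: "(\<lambda>k. x ^ k /\<^sub>R fact k) sums exp x" by (rule exp_converges)
  have "(\<Sum>k\<in>{n}. x ^ k /\<^sub>R fact k) \<le> (\<Sum>k. x ^ k /\<^sub>R fact k)"
    using assms by (intro sum_le_suminf sums_summable[OF s]) auto
  then show ?thesis unfolding sums_unique[OF s, symmetric] by (simp add: divide_inverse mult.commute)
qed

text \<open>The difference of the two sides vanishes at 0 and has derivative
  \<open>exp y + exp (- y) - 2\<close>, nonnegative by \<open>1 + y \<le> exp y\<close> applied to
  \<open>y\<close> and \<open>- y\<close>. The bound turns distances of exponential nodes into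
  distances of integers.\<close>

lemma le_sinh_real:
  fixes x :: real
  assumes "x \<ge> 0"
  shows "2 * x \<le> exp x - exp (- x)"
proof -
  define g where "g = (\<lambda>x::real. exp x - exp (- x) - 2 * x)"
  have "g 0 \<le> g x"
  proof (rule DERIV_nonneg_imp_nondecreasing[OF assms])
    fix y :: real assume "0 \<le> y" "y \<le> x"
    have "(g has_real_derivative (exp y + exp (- y) - 2)) (at y)"
      unfolding g_def by (auto intro!: derivative_eq_intros)
    moreover have "exp y + exp (- y) - 2 \<ge> 0"
      using exp_ge_add_one_self[of y] exp_ge_add_one_self[of "-y"] by linarith
    ultimately show "\<exists>d. (g has_real_derivative d) (at y) \<and> 0 \<le> d" by blast
  qed
  then show ?thesis by (simp add: g_def)
qed

text \<open>The factors with \<open>m < l\<close> multiply to \<open>fact l\<close>, those with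
  \<open>m > l\<close> to \<open>fact (n - l)\<close>. This evaluates the Lagrange denominators
  after the nodes have been replaced by integers.\<close>

lemma prod_dist_nat_eq_fact:
  assumes "l \<le> n"
  shows "(\<Prod>m\<in>{..n} - {l}. \<bar>real l - real m\<bar>) = fact l * fact (n - l)"
proof -
  have *: "{..n} - {l} = {..<l} \<union> {Suc l..n}" using assms by auto
  have 1: "(\<Prod>m<l. \<bar>real l - real m\<bar>) = fact l"
  proof -
    have "(\<Prod>m<l. \<bar>real l - real m\<bar>) = (\<Prod>m<l. real (l - m))" by (intro prod.cong) auto
    also have "\<dots> = (\<Prod>m\<in>{1..l}. real m)"
      by (intro prod.reindex_bij_witness[of _ "\<lambda>m. l - m" "\<lambda>m. l - m"]) auto
    finally show ?thesis by (simp add: fact_prod)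
  qed
  have 2: "(\<Prod>m\<in>{Suc l..n}. \<bar>real l - real m\<bar>) = fact (n - l)"
  proof -
    have "(\<Prod>m\<in>{Suc l..n}. \<bar>real l - real m\<bar>) = (\<Prod>m\<in>{1..n-l}. real m)"
      by (intro prod.reindex_bij_witness[of _ "\<lambda>m. m + l" "\<lambda>m. m - l"]) auto
    then show ?thesis by (simp add: fact_prod)
  qed
  have "{..<l} \<inter> {Suc l..n} = {}" by auto
  then show ?thesis unfolding * by (subst prod.union_disjoint) (simp_all only: 1 2 finite_lessThan finite_atLeastAtMost)
qed

section \<open>Lagrange interpolation and coefficient norms\<close>

text \<open>Both sides have degree below \<open>card I\<close> and agree at \<open>card I\<close>
  distinct nodes.\<close>

lemma lagrange_interpolation:
  fixes x :: "'i \<Rightarrow> 'a::field"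
  assumes fin: "finite I" and inj: "inj_on x I" and deg: "degree p < card I"
  shows "p = (\<Sum>l\<in>I. Polynomial.smult (poly p (x l) / (\<Prod>m\<in>I - {l}. x l - x m)) (\<Prod>m\<in>I - {l}. [:- x m, 1:]))"
    (is "p = ?q")
proof (rule poly_eqI_degree[of "x ` I"])
  show "poly p y = poly ?q y" if y: "y \<in> x ` I" for y
  proof -
    obtain k where k: "k \<in> I" "y = x k" using y by auto
    have "poly ?q y = (\<Sum>l\<in>I. poly p (x l) / (\<Prod>m\<in>I - {l}. x l - x m) * (\<Prod>m\<in>I - {l}. x k - x m))"
      by (simp add: poly_sum poly_prod k)
    \<comment> \<open>For \<open>l \<noteq> k\<close> the last product contains the factor with
      \<open>m = k\<close>, which is zero.\<close>
    also have "\<dots> = (\<Sum>l\<in>{k}. poly p (x l) / (\<Prod>m\<in>I - {l}. x l - x m) * (\<Prod>m\<in>I - {l}. x k - x m))"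
      using fin k by (intro sum.mono_neutral_right) auto
    also have "\<dots> = poly p (x k)"
    proof -
      have "(\<Prod>m\<in>I - {k}. x k - x m) \<noteq> 0"
        using fin k inj by (auto simp: inj_on_eq_iff)
      then show ?thesis by simp
    qed
    finally show ?thesis using k by simp
  qed
  show "card (x ` I) > degree p" using deg inj by (simp add: card_image)
  have "degree ?q \<le> card I - 1"
  proof (intro degree_sum_le fin)
    fix l assume "l \<in> I"
    have "degree (\<Prod>m\<in>I - {l}. [:- x m, 1:]) \<le> sum (degree \<circ> (\<lambda>m. [:- x m, 1:])) (I - {l})"
      using fin by (intro degree_prod_sum_le) auto
    also have "\<dots> = card I - 1" using fin \<open>l \<in> I\<close> by simp
    finally show "degree (Polynomial.smult (poly p (x l) / (\<Prod>m\<in>I - {l}. x l - x m)) (\<Prod>m\<in>I - {l}. [:- x m, 1:])) \<le> card I - 1"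
      by (meson degree_smult_le order_trans)
  qed
  then show "card (x ` I) > degree ?q" using deg inj by (simp add: card_image)
qed

text \<open>The l1 norm of coefficients is submultiplicative, and the linear factor with root
  \<open>x m\<close> has norm \<open>1 + \<bar>x m\<bar>\<close>. Truncating at an arbitrary
  \<open>n\<close> keeps degrees out of the induction.\<close>

lemma sum_abs_coeff_prod_linear_le:
  fixes x :: "'i \<Rightarrow> real"
  assumes "finite A"
  shows "(\<Sum>j\<le>n. \<bar>Polynomial.coeff (\<Prod>m\<in>A. [:- x m, 1:]) j\<bar>) \<le> (\<Prod>m\<in>A. 1 + \<bar>x m\<bar>)"
  using assms
proof (induction A rule: finite_induct)
  case empty
  have "(\<Sum>j\<le>n. \<bar>Polynomial.coeff (1::real poly) j\<bar>) = (\<Sum>j\<in>{0}. \<bar>Polynomial.coeff (1::real poly) j\<bar>)"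
    by (intro sum.mono_neutral_right) auto
  then show ?case by simp
next
  case (insert a A)
  define p where "p = (\<Prod>m\<in>A. [:- x m, 1:])"
  have "(\<Sum>j\<le>n. \<bar>Polynomial.coeff ([:- x a, 1:] * p) j\<bar>) \<le>
      (\<Sum>j\<le>n. \<bar>x a\<bar> * \<bar>Polynomial.coeff p j\<bar> + \<bar>Polynomial.coeff (pCons 0 p) j\<bar>)"
    by (intro sum_mono) (auto simp: abs_mult intro: order_trans[OF abs_triangle_ineq4]
        order_trans[OF abs_triangle_ineq])
  also have "\<dots> = \<bar>x a\<bar> * (\<Sum>j\<le>n. \<bar>Polynomial.coeff p j\<bar>) + (\<Sum>j\<le>n. \<bar>Polynomial.coeff (pCons 0 p) j\<bar>)"
    by (simp add: sum.distrib sum_distrib_left)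
  \<comment> \<open>Multiplication by the variable shifts the coefficients up by one, so the
    truncated sum can only lose the coefficient of index \<open>n\<close>.\<close>
  also have "(\<Sum>j\<le>n. \<bar>Polynomial.coeff (pCons 0 p) j\<bar>) \<le> (\<Sum>j\<le>n. \<bar>Polynomial.coeff p j\<bar>)"
  proof (cases n)
    case (Suc k)
    then have "(\<Sum>j\<le>n. \<bar>Polynomial.coeff (pCons 0 p) j\<bar>) = (\<Sum>j\<le>k. \<bar>Polynomial.coeff p j\<bar>)"
      by (simp add: sum.atMost_Suc_shift del: sum.atMost_Suc)
    also have "\<dots> \<le> (\<Sum>j\<le>n. \<bar>Polynomial.coeff p j\<bar>)" using Suc by (intro sum_mono2) auto
    finally show ?thesis .
  qed simp
  also have "\<bar>x a\<bar> * (\<Sum>j\<le>n. \<bar>Polynomial.coeff p j\<bar>) + (\<Sum>j\<le>n. \<bar>Polynomial.coeff p j\<bar>) = (1 + \<bar>x a\<bar>) * (\<Sum>j\<le>n. \<bar>Polynomial.coeff p j\<bar>)"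
    by (simp add: algebra_simps)
  also have "\<dots> \<le> (1 + \<bar>x a\<bar>) * (\<Prod>m\<in>A. 1 + \<bar>x m\<bar>)"
    using insert.IH unfolding p_def by (intro mult_left_mono) auto
  finally show ?case using insert.hyps by (simp add: p_def)
qed

text \<open>Lagrange's formula recovers the coefficients from the values; the triangle inequality
  then leaves the l1 norm of each nodal product.\<close>

lemma sum_abs_coeff_le_values:
  fixes x :: "nat \<Rightarrow> real"
  assumes inj: "inj_on x {..n}" and deg: "degree p \<le> n"
  shows "(\<Sum>j\<le>n. \<bar>Polynomial.coeff p j\<bar>) \<le>
    (\<Sum>l\<le>n. \<bar>poly p (x l)\<bar> * (\<Prod>m\<in>{..n} - {l}. (1 + \<bar>x m\<bar>) / \<bar>x l - x m\<bar>))"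
proof -
  define c where "c l = \<bar>poly p (x l)\<bar> / (\<Prod>m\<in>{..n} - {l}. \<bar>x l - x m\<bar>)" for l
  define L where "L l = (\<Prod>m\<in>{..n} - {l}. [:- x m, 1:])" for l
  have p: "p = (\<Sum>l\<le>n. Polynomial.smult (poly p (x l) / (\<Prod>m\<in>{..n} - {l}. x l - x m)) (L l))"
    unfolding L_def by (rule lagrange_interpolation) (use inj deg in auto)
  have "\<bar>Polynomial.coeff p j\<bar> \<le> (\<Sum>l\<le>n. c l * \<bar>Polynomial.coeff (L l) j\<bar>)" for j
  proof -
    have "Polynomial.coeff p j = (\<Sum>l\<le>n. poly p (x l) / (\<Prod>m\<in>{..n} - {l}. x l - x m) * Polynomial.coeff (L l) j)"
      by (subst p) (simp add: coeff_sum)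
    then show ?thesis
      by (auto simp: c_def abs_mult abs_prod intro!: order_trans[OF sum_abs] sum_mono)
  qed
  then have "(\<Sum>j\<le>n. \<bar>Polynomial.coeff p j\<bar>) \<le> (\<Sum>j\<le>n. \<Sum>l\<le>n. c l * \<bar>Polynomial.coeff (L l) j\<bar>)"
    by (intro sum_mono) auto
  also have "\<dots> = (\<Sum>l\<le>n. c l * (\<Sum>j\<le>n. \<bar>Polynomial.coeff (L l) j\<bar>))"
    by (subst sum.swap) (simp add: sum_distrib_left)
  also have "\<dots> \<le> (\<Sum>l\<le>n. c l * (\<Prod>m\<in>{..n} - {l}. 1 + \<bar>x m\<bar>))"
    unfolding L_def
    by (intro sum_mono mult_left_mono sum_abs_coeff_prod_linear_le) (auto simp: c_def prod_nonneg)
  also have "\<dots> = (\<Sum>l\<le>n. \<bar>poly p (x l)\<bar> * (\<Prod>m\<in>{..n} - {l}. (1 + \<bar>x m\<bar>) / \<bar>x l - x m\<bar>))"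
    by (simp add: c_def prod_dividef)
  finally show ?thesis .
qed

section \<open>Coefficients of exponential sums from equispaced samples\<close>

text \<open>Taking \<open>exp (- a * l / 2) * exp (- a * m / 2)\<close> out of the node difference
  leaves 2 sinh \<open>d\<close>, where \<open>d\<close> is half the distance of the exponents. The
  numerator is likewise \<open>exp (- a * m / 2)\<close> times a hyperbolic cosine, so the outer
  factors cancel, and sinh \<open>d\<close> is at least \<open>d\<close>.\<close>

lemma exp_node_factor_le:
  fixes a :: real and l m :: nat
  assumes "a > 0" "l \<noteq> m"
  shows "exp (- a * l / 2) * ((1 + exp (- a * m)) / \<bar>exp (- a * l) - exp (- a * m)\<bar>)
      \<le> exp (a * m / 2) * (2 / a) / \<bar>real l - real m\<bar>"
proof -
  define d where "d = a * \<bar>real l - real m\<bar> / 2"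
  have d: "d > 0" using assms by (simp add: d_def)
  have D: "\<bar>exp (- a * l) - exp (- a * m)\<bar> = exp (- a * l / 2) * exp (- a * m / 2) * (exp d - exp (- d))"
  proof (cases "l < m")
    case True
    then have "exp (- a * m) \<le> exp (- a * l)" using assms by simp
    then show ?thesis using True
      by (simp add: d_def exp_add[symmetric] algebra_simps add_divide_distrib[symmetric] diff_divide_distrib[symmetric])
  next
    case False
    then have "exp (- a * l) \<le> exp (- a * m)" using assms by simp
    then show ?thesis using False
      by (simp add: d_def exp_add[symmetric] algebra_simps add_divide_distrib[symmetric] diff_divide_distrib[symmetric])
  qed
  have "1 + exp (- a * m) = exp (- a * m / 2) * (exp (a * m / 2) + exp (- a * m / 2))"
    by (simp add: exp_add[symmetric] algebra_simps)
  then have "exp (- a * l / 2) * ((1 + exp (- a * m)) / \<bar>exp (- a * l) - exp (- a * m)\<bar>)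
      = (exp (a * m / 2) + exp (- a * m / 2)) / (exp d - exp (- d))"
    unfolding D by simp
  also have "\<dots> \<le> (2 * exp (a * m / 2)) / (2 * d)"
  proof (rule frac_le)
    show "exp (a * m / 2) + exp (- a * m / 2) \<le> 2 * exp (a * m / 2)" using assms by simp
    show "2 * d \<le> exp d - exp (- d)" using d by (intro le_sinh_real) simp
  qed (use d in auto)
  also have "\<dots> = exp (a * m / 2) * (2 / a) / \<bar>real l - real m\<bar>"
    using assms by (simp add: d_def field_simps)
  finally show ?thesis .
qed


lemma sum_inverse_fact_mult_fact:
  "(\<Sum>l\<le>n. 1 / (fact l * fact (n - l))) = (2 ^ n / fact n :: real)"
proof -
  have "(\<Sum>l\<le>n. 1 / (fact l * fact (n - l))) = (\<Sum>l\<le>n. real (n choose l) / fact n)"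
    by (intro sum.cong) (auto simp: binomial_fact)
  also have "\<dots> = real (\<Sum>l\<le>n. n choose l) / fact n"
    by (simp add: sum_divide_distrib)
  finally show ?thesis by (simp add: choose_row_sum)
qed

text \<open>Up to a scaling, the samples are values at the nodes \<open>exp (- a * l)\<close> of the
  polynomial with coefficients \<open>u\<close>, so Lagrange interpolation applies. The factors
  \<open>exp (a * m / 2)\<close> give the exponential in the bound, and the integer distances give
  reciprocal factorials, summed by the binomial theorem.\<close>

lemma exponential_sum_coeff_bound:
  fixes a F :: real and u :: "nat \<Rightarrow> real"
  assumes a: "a > 0"
    and F: "\<And>l. l \<le> n \<Longrightarrow> \<bar>\<Sum>j\<le>n. u j * exp (- a * real l * (real j - real n / 2))\<bar> \<le> F"
  shows "(\<Sum>j\<le>n. \<bar>u j\<bar>) \<le> F * exp (a * n * (n + 1) / 4) * ((4 / a) ^ n / fact n)"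
proof -
  define p where "p = (\<Sum>j\<le>n. monom (u j) j)"
  define x where "x l = exp (- a * real l)" for l :: nat
  define f where "f l = (\<Sum>j\<le>n. u j * exp (- a * real l * (real j - real n / 2)))" for l
  have cp: "Polynomial.coeff p j = u j" if "j \<le> n" for j
    using that by (simp add: p_def coeff_sum if_distrib cong: if_cong)
  have F0: "F \<ge> 0" using F[of 0] by (meson abs_ge_zero le0 order_trans)
  have deg: "degree p \<le> n"
    unfolding p_def by (intro degree_sum_le) (auto intro: order_trans[OF degree_monom_le])
  have inj: "inj_on x {..n}" using a by (auto simp: inj_on_def x_def)
  \<comment> \<open>Centring the exponents at \<open>n / 2\<close> costs the factor
    \<open>x l\<close> to the power \<open>n / 2\<close>. Written as an \<open>n\<close>-th power,
    it supplies one copy to each of the \<open>n\<close> Lagrange factors.\<close>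
  have pf: "poly p (x l) = exp (- a * l / 2) ^ n * f l" for l
  proof -
    have "u j * x l ^ j = exp (- a * l / 2) ^ n * (u j * exp (- a * real l * (real j - real n / 2)))" for j
      by (simp add: x_def exp_of_nat_mult[symmetric] exp_add[symmetric] algebra_simps)
    then have "(\<Sum>j\<le>n. u j * x l ^ j) = (\<Sum>j\<le>n. exp (- a * l / 2) ^ n * (u j * exp (- a * real l * (real j - real n / 2))))"
      by (intro sum.cong refl)
    then show ?thesis unfolding p_def f_def by (simp only: poly_sum poly_monom sum_distrib_left)
  qed
  have node_bound: "\<bar>poly p (x l)\<bar> * (\<Prod>m\<in>{..n} - {l}. (1 + \<bar>x m\<bar>) / \<bar>x l - x m\<bar>)
      \<le> F * exp (a * n * (n + 1) / 4) * (2 / a) ^ n * (1 / (fact l * fact (n - l)))" if l: "l \<le> n" for l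
  proof -
    have cd: "card ({..n} - {l}) = n" using l by simp
    have "\<bar>poly p (x l)\<bar> * (\<Prod>m\<in>{..n} - {l}. (1 + \<bar>x m\<bar>) / \<bar>x l - x m\<bar>)
        = \<bar>f l\<bar> * (\<Prod>m\<in>{..n} - {l}. exp (- a * l / 2) * ((1 + exp (- a * m)) / \<bar>exp (- a * l) - exp (- a * m)\<bar>))"
    proof -
      have "(\<Prod>m\<in>{..n} - {l}. exp (- a * l / 2)) = exp (- a * l / 2) ^ n"
        by (simp only: prod_constant cd)
      then show ?thesis unfolding pf prod.distrib by (simp add: abs_mult x_def)
    qed
    also have "\<dots> \<le> F * (\<Prod>m\<in>{..n} - {l}. exp (a * m / 2) * (2 / a) / \<bar>real l - real m\<bar>)"
    proof (rule mult_mono[OF _ prod_mono])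
      show "\<bar>f l\<bar> \<le> F" unfolding f_def by (rule F[OF l])
      fix m assume "m \<in> {..n} - {l}"
      then have "l \<noteq> m" by simp
      from exp_node_factor_le[OF a this]
      show "0 \<le> exp (- a * l / 2) * ((1 + exp (- a * m)) / \<bar>exp (- a * l) - exp (- a * m)\<bar>) \<and>
          exp (- a * l / 2) * ((1 + exp (- a * m)) / \<bar>exp (- a * l) - exp (- a * m)\<bar>)
          \<le> exp (a * m / 2) * (2 / a) / \<bar>real l - real m\<bar>" by simp
    next
      show "0 \<le> (\<Prod>m\<in>{..n} - {l}. exp (- a * l / 2) * ((1 + exp (- a * m)) / \<bar>exp (- a * l) - exp (- a * m)\<bar>))"
        by (intro prod_nonneg) simp
    qed (rule F0)
    also have "(\<Prod>m\<in>{..n} - {l}. exp (a * m / 2) * (2 / a) / \<bar>real l - real m\<bar>)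
       = (\<Prod>m\<in>{..n} - {l}. exp (a * m / 2)) * (2 / a) ^ n / (fact l * fact (n - l))"
    proof -
      have "(\<Prod>m\<in>{..n} - {l}. 2 / a) = (2 / a) ^ n"
        by (simp only: prod_constant cd)
      then show ?thesis by (simp only: prod_dividef[of _ "\<lambda>m. \<bar>real l - real m\<bar>"] prod.distrib prod_dist_nat_eq_fact[OF l])
    qed
    also have "(\<Prod>m\<in>{..n} - {l}. exp (a * m / 2)) = exp (\<Sum>m\<in>{..n} - {l}. a * m / 2)"
      by (simp add: exp_sum)
    \<comment> \<open>Adding the nonnegative term \<open>m = l\<close> makes the exponent
      independent of \<open>l\<close>.\<close>
    also have "(\<Sum>m\<in>{..n} - {l}. a * m / 2) \<le> (\<Sum>m\<le>n. a * m / 2)"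
      using a by (intro sum_mono2) auto
    also have "(\<Sum>m\<le>n. a * m / 2) = a / 2 * (\<Sum>m\<le>n. real m)"
      by (simp add: sum_distrib_left)
    also have "(\<Sum>m\<le>n. real m) = real n * (real n + 1) / 2"
      by (induction n) (auto simp: field_simps)
    finally have "\<bar>poly p (x l)\<bar> * (\<Prod>m\<in>{..n} - {l}. (1 + \<bar>x m\<bar>) / \<bar>x l - x m\<bar>)
      \<le> F * (exp (a / 2 * (real n * (real n + 1) / 2)) * (2 / a) ^ n / (fact l * fact (n - l)))"
      using a F0 by (simp add: mult_left_mono divide_right_mono mult_right_mono)
    moreover have "a / 2 * (real n * (real n + 1) / 2) = a * n * (n + 1) / 4" by simp
    ultimately show ?thesis by (simp add: mult.assoc add.commute)
  qed
  have "(\<Sum>j\<le>n. \<bar>u j\<bar>) = (\<Sum>j\<le>n. \<bar>Polynomial.coeff p j\<bar>)" by (simp add: cp)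
  also have "\<dots> \<le> (\<Sum>l\<le>n. \<bar>poly p (x l)\<bar> * (\<Prod>m\<in>{..n} - {l}. (1 + \<bar>x m\<bar>) / \<bar>x l - x m\<bar>))"
    by (rule sum_abs_coeff_le_values[OF inj deg])
  also have "\<dots> \<le> (\<Sum>l\<le>n. F * exp (a * n * (n + 1) / 4) * (2 / a) ^ n * (1 / (fact l * fact (n - l))))"
    by (intro sum_mono node_bound) auto
  also have "\<dots> = F * exp (a * n * (n + 1) / 4) * (2 / a) ^ n * (2 ^ n / fact n)"
    by (simp only: sum_distrib_left[symmetric] sum_inverse_fact_mult_fact)
  also have "\<dots> = F * exp (a * n * (n + 1) / 4) * ((2 / a * 2) ^ n / fact n)"
    by (simp only: power_mult_distrib) simp
  finally show ?thesis by simp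
qed

section \<open>Lower bound from the residue classes of rows\<close>

text \<open>By division with remainder, \<open>k + q * l\<close> runs exactly once through the
  indices below \<open>q * (n + 1)\<close>; for fixed \<open>l\<close> these form a block of length
  \<open>q\<close>.\<close>

lemma sum_residue_classes_le:
  fixes g :: "nat \<Rightarrow> real"
  assumes "\<And>i. g i \<ge> 0" "q * (n + 1) \<le> M"
  shows "(\<Sum>k<q. \<Sum>l\<le>n. g (k + q * l)) \<le> (\<Sum>i<M. g i)"
proof -
  have "(\<Sum>k<q. \<Sum>l\<le>n. g (k + q * l)) = (\<Sum>l<n + 1. \<Sum>k<q. g (k + q * l))"
    by (subst sum.swap) (simp add: lessThan_Suc_atMost)
  also have "\<dots> = (\<Sum>l<n + 1. sum g {l * q..<l * q + q})"
  proof (rule sum.cong[OF refl])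
    fix l
    show "(\<Sum>k<q. g (k + q * l)) = sum g {l * q..<l * q + q}"
      by (rule sum.reindex_bij_witness[of _ "\<lambda>i. i - q * l" "\<lambda>k. k + q * l"])
        (auto simp: algebra_simps)
  qed
  also have "\<dots> = (\<Sum>i<(n + 1) * q. g i)" by (rule sum.nat_group)
  also have "\<dots> \<le> (\<Sum>i<M. g i)"
    using assms by (intro sum_mono2) (auto simp: mult.commute)
  finally show ?thesis .
qed

lemma sum_squares_le_square_sum_abs:
  fixes v :: "'i \<Rightarrow> real"
  shows "(\<Sum>j\<in>A. (v j)\<^sup>2) \<le> (\<Sum>j\<in>A. \<bar>v j\<bar>)\<^sup>2"
  using L2_set_le_sum_abs[of v A] unfolding L2_set_def
  by (meson real_sqrt_le_iff sqrt_le_D)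

text \<open>Row \<open>k\<close> is absorbed into the coefficients \<open>u\<close>, leaving an
  equispaced centred exponential sum in \<open>l\<close>. One factor
  \<open>exp (\<beta> * \<mu>)\<close> comes from the interpolation bound, the other from passing
  back from \<open>u\<close> to \<open>v\<close>.\<close>

lemma residue_class_lower_bound:
  fixes \<beta> \<mu> :: real and n\<^sub>s n q k :: nat and v :: "nat \<Rightarrow> real"
  assumes pos: "\<beta> > 0" "\<mu> > 0" and n: "1 \<le> n" "n \<le> n\<^sub>s" and k: "k < q"
    and q: "q * (n + 1) \<le> n\<^sub>s + 1" "n\<^sub>s + 1 \<le> (q + 1) * (n + 1)"
    and B: "real (n + 1) \<le> \<beta> * \<mu> / (2 * exp 1)"
  defines "f \<equiv> \<lambda>i::nat. \<Sum>j\<le>n. exp (- (\<beta> / n\<^sub>s * i) * (- \<mu> + 2 * \<mu> / n * j)) * v j"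
  shows "(\<Sum>j\<le>n. (v j)\<^sup>2) \<le> (exp (2 * (\<beta> * \<mu>)) * (1 + 1 / q) ^ n)\<^sup>2 * (\<Sum>l\<le>n. (f (k + q * l))\<^sup>2)"
proof -
  define b where "b = \<beta> * \<mu>"
  \<comment> \<open>Product of the spacing \<open>\<beta> * q / n\<^sub>s\<close> of the selected
    rows and the column spacing \<open>2 * \<mu> / n\<close>.\<close>
  define a where "a = 2 * b * q / (n\<^sub>s * n)"
  define u where "u j = v j * exp (- (\<beta> / n\<^sub>s * k) * (- \<mu> + 2 * \<mu> / n * j))" for j :: nat
  define F where "F = L2_set (\<lambda>l. f (k + q * l)) {..n}"
  have b: "b > 0" and q0: "q > 0" and ns0: "n\<^sub>s > 0" and n0: "n > 0"
    using pos n k by (auto simp: b_def)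
  have a: "a > 0" using b q0 ns0 n0 by (simp add: a_def)
  \<comment> \<open>The column point \<open>- \<mu> + 2 * \<mu> / n * j\<close> equals
    \<open>2 * \<mu> / n\<close> times \<open>j - n / 2\<close>, which is the centring
    required.\<close>
  have fu: "(\<Sum>j\<le>n. u j * exp (- a * real l * (real j - real n / 2))) = f (k + q * l)" for l
    unfolding f_def
  proof (rule sum.cong[OF refl])
    fix j
    have "- (\<beta> / n\<^sub>s * k) * (- \<mu> + 2 * \<mu> / n * j) + (- a * real l * (real j - real n / 2))
       = - (\<beta> / n\<^sub>s * real (k + q * l)) * (- \<mu> + 2 * \<mu> / n * j)"
      using ns0 n0 by (simp add: a_def b_def divide_simps) (simp add: algebra_simps)
    then show "u j * exp (- a * real l * (real j - real n / 2)) =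
        exp (- (\<beta> / n\<^sub>s * real (k + q * l)) * (- \<mu> + 2 * \<mu> / n * j)) * v j"
      by (simp add: u_def exp_add[symmetric] mult.assoc)
  qed
  have U: "(\<Sum>j\<le>n. \<bar>u j\<bar>) \<le> F * exp (a * n * (n + 1) / 4) * ((4 / a) ^ n / fact n)"
  proof (rule exponential_sum_coeff_bound[OF a])
    fix l assume "l \<le> n"
    then have "(f (k + q * l))\<^sup>2 \<le> (\<Sum>l\<le>n. (f (k + q * l))\<^sup>2)"
      by (intro member_le_sum) auto
    then show "\<bar>\<Sum>j\<le>n. u j * exp (- a * real l * (real j - real n / 2))\<bar> \<le> F"
      unfolding fu F_def L2_set_def by (rule real_le_rsqrt[of "\<bar>_\<bar>", simplified])
  qed
  \<comment> \<open>The exponent is \<open>b * q * (n + 1) / (2 * n\<^sub>s)\<close>, and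
    \<open>q * (n + 1) \<le> n\<^sub>s + 1 \<le> 2 * n\<^sub>s\<close>.\<close>
  have e1: "exp (a * n * (n + 1) / 4) \<le> exp b"
  proof -
    have "a * n * (n + 1) / 4 = b * (real (q * (n + 1)) / (2 * n\<^sub>s))"
      using n0 by (simp add: a_def) (simp add: algebra_simps)
    also have "real (q * (n + 1)) / (2 * n\<^sub>s) \<le> real (n\<^sub>s + 1) / (2 * n\<^sub>s)"
      using q(1) by (intro divide_right_mono of_nat_mono) auto
    also have "real (n\<^sub>s + 1) / (2 * n\<^sub>s) \<le> 1" using ns0 by simp
    finally show ?thesis using b by simp
  qed
  have e2: "(4 / a) ^ n / fact n \<le> (1 + 1 / q) ^ n"
  proof -
    \<comment> \<open>Chosen so that \<open>4 / a = n * y\<close>: the split-off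
      \<open>n ^ n\<close> absorbs the factorial at the price of \<open>exp n\<close>.\<close>
    define y where "y = 2 * n\<^sub>s / (b * q)"
    have "4 / a = n * y" by (simp add: a_def y_def)
    then have "(4 / a) ^ n / fact n = real n ^ n / fact n * y ^ n" by (simp add: power_mult_distrib)
    also have "\<dots> \<le> exp (real n) * y ^ n"
      using b by (intro mult_right_mono power_divide_fact_le_exp) (auto simp: y_def)
    also have "\<dots> = (exp 1 * y) ^ n" by (simp add: power_mult_distrib exp_of_nat_mult[symmetric])
    also have "\<dots> \<le> (1 + 1 / q) ^ n"
    proof (rule power_mono)
      \<comment> \<open>The assumption on \<open>\<beta> * \<mu>\<close> enters here, as
        \<open>b / (2 * exp 1) \<ge> n + 1\<close>; the maximality of \<open>q\<close> then bounds
        the quotient.\<close>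
      have "exp 1 * y = real n\<^sub>s / q / (b / (2 * exp 1))" by (simp add: y_def field_simps)
      also have "\<dots> \<le> real n\<^sub>s / q / real (n + 1)"
        using B b by (intro divide_left_mono) (auto simp: b_def)
      also have "\<dots> \<le> real ((q + 1) * (n + 1)) / q / real (n + 1)"
        using q(2) by (intro divide_right_mono of_nat_mono) auto
      also have "\<dots> = 1 + 1 / q"
      proof -
        have "x * y / z / y = x / z" if "y \<noteq> 0" for x y z :: real
          using that by simp
        from this[of "real (n + 1)" "real (q + 1)" q]
        have "real ((q + 1) * (n + 1)) / q / real (n + 1) = real (q + 1) / q"
          unfolding of_nat_mult by simp
        then show ?thesis using q0 by (simp add: add_divide_distrib)
      qed
      finally show "exp 1 * y \<le> 1 + 1 / q" .
      show "0 \<le> exp 1 * y" using b by (simp add: y_def)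
    qed
    finally show ?thesis .
  qed
  have kn: "k \<le> n\<^sub>s" using k q(1) by (simp add: algebra_simps)
  \<comment> \<open>Undoing the row scaling costs at most \<open>exp b\<close>, as the row point is
    at most \<open>\<beta>\<close> and the column point at most \<open>\<mu>\<close>.\<close>
  have vu: "\<bar>v j\<bar> \<le> exp b * \<bar>u j\<bar>" if "j \<le> n" for j
  proof -
    have "v j = exp (\<beta> / n\<^sub>s * k * (- \<mu> + 2 * \<mu> / n * j)) * u j"
      by (simp add: u_def exp_minus)
    moreover have "\<beta> / n\<^sub>s * k * (- \<mu> + 2 * \<mu> / n * j) \<le> \<beta> * \<mu>"
    proof -
      have "- \<mu> + 2 * \<mu> / n * j \<le> \<mu>" using that pos n0 by (simp add: field_simps)
      then have "\<beta> / n\<^sub>s * k * (- \<mu> + 2 * \<mu> / n * j) \<le> \<beta> / n\<^sub>s * k * \<mu>"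
        using pos by (intro mult_left_mono) auto
      also have "\<dots> \<le> \<beta> * \<mu>"
        using kn pos ns0 by (intro mult_right_mono) (auto simp: field_simps)
      finally show ?thesis .
    qed
    ultimately show ?thesis by (simp add: b_def abs_mult mult_right_mono)
  qed
  have F0: "F \<ge> 0" by (simp add: F_def)
  have "(\<Sum>j\<le>n. \<bar>v j\<bar>) \<le> exp b * (\<Sum>j\<le>n. \<bar>u j\<bar>)"
    unfolding sum_distrib_left by (intro sum_mono vu) auto
  also have "\<dots> \<le> exp b * (F * exp b * (1 + 1 / q) ^ n)"
    using U e1 e2 F0 a by (intro mult_left_mono order_trans[OF U] mult_mono) auto
  also have "\<dots> = exp (2 * b) * (1 + 1 / q) ^ n * F"
  proof -
    have "exp (2 * b) = exp b * exp b" by (simp add: exp_add[symmetric])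
    then show ?thesis by simp
  qed
  finally have "(\<Sum>j\<le>n. \<bar>v j\<bar>)\<^sup>2 \<le> (exp (2 * b) * (1 + 1 / q) ^ n * F)\<^sup>2"
    by (intro power_mono) (auto intro: sum_nonneg)
  moreover have "F\<^sup>2 = (\<Sum>l\<le>n. (f (k + q * l))\<^sup>2)"
    by (simp add: F_def L2_set_def sum_nonneg)
  ultimately show ?thesis
    using sum_squares_le_square_sum_abs[of v "{..n}"] by (simp add: power_mult_distrib b_def)
qed

section \<open>Spectrum of the Gram matrix and the condition number\<close>

text \<open>Comparing real and imaginary parts of a complex eigenvector forces its eigenvalue to be real.\<close>

lemma real_symmetric_spectrum_nonempty:
  fixes A :: "real mat"
  assumes A: "A \<in> carrier_mat n n" and n: "n > 0"
    and sym: "\<And>x y. x \<in> carrier_vec n \<Longrightarrow> y \<in> carrier_vec n \<Longrightarrow> x \<bullet> (A *\<^sub>v y) = (A *\<^sub>v x) \<bullet> y"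
  shows "spectrum A \<noteq> {}"
proof -
  define C where "C = map_mat complex_of_real A"
  have C: "C \<in> carrier_mat n n" using A by (simp add: C_def)
  from spectrum_non_empty[OF C n] obtain ev z where z: "z \<in> carrier_vec n" "z \<noteq> 0\<^sub>v n"
    and evz: "C *\<^sub>v z = ev \<cdot>\<^sub>v z"
    using C by (auto simp: spectrum_def eigenvalue_def eigenvector_def)
  define x where "x = map_vec Re z"
  define y where "y = map_vec Im z"
  have x: "x \<in> carrier_vec n" and y: "y \<in> carrier_vec n" using z by (auto simp: x_def y_def)
  have comp: "(\<Sum>j<n. complex_of_real (A $$ (i, j)) * z $ j) = ev * z $ i" if "i < n" for i
  proof -
    have "(C *\<^sub>v z) $ i = (ev \<cdot>\<^sub>v z) $ i" by (simp add: evz)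
    then show ?thesis using that A z
      by (simp add: C_def scalar_prod_def atLeast0LessThan)
  qed
  have Ax: "A *\<^sub>v x = Re ev \<cdot>\<^sub>v x - Im ev \<cdot>\<^sub>v y"
  proof (rule eq_vecI)
    fix i assume "i < dim_vec (Re ev \<cdot>\<^sub>v x - Im ev \<cdot>\<^sub>v y)"
    then have "i < n" using y by simp
    then show "(A *\<^sub>v x) $ i = (Re ev \<cdot>\<^sub>v x - Im ev \<cdot>\<^sub>v y) $ i"
      using arg_cong[OF comp, of i Re] A z
      by (simp add: x_def y_def scalar_prod_def atLeast0LessThan)
  qed (use A y in auto)
  have Ay: "A *\<^sub>v y = Im ev \<cdot>\<^sub>v x + Re ev \<cdot>\<^sub>v y"
  proof (rule eq_vecI)
    fix i assume "i < dim_vec (Im ev \<cdot>\<^sub>v x + Re ev \<cdot>\<^sub>v y)"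
    then have "i < n" using y by simp
    then show "(A *\<^sub>v y) $ i = (Im ev \<cdot>\<^sub>v x + Re ev \<cdot>\<^sub>v y) $ i"
      using arg_cong[OF comp, of i Im] A z
      by (simp add: x_def y_def scalar_prod_def atLeast0LessThan algebra_simps)
  qed (use A y in auto)
  have nz: "x \<noteq> 0\<^sub>v n \<or> y \<noteq> 0\<^sub>v n"
  proof (rule ccontr)
    assume "\<not> ?thesis"
    then have "Re (z $ i) = 0 \<and> Im (z $ i) = 0" if "i < n" for i
      using that z by (auto simp: x_def y_def vec_eq_iff)
    then have "z = 0\<^sub>v n" using z by (intro eq_vecI) (auto simp: complex_eq_iff)
    then show False using z by simp
  qed
  have pos: "w \<bullet> w > 0" if "w \<in> carrier_vec n" "w \<noteq> 0\<^sub>v n" for w :: "real vec"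
    using that conjugate_square_greater_0_vec[of w] by simp
  have ge: "w \<bullet> w \<ge> 0" if "w \<in> carrier_vec n" for w :: "real vec"
    using that conjugate_square_ge_0_vec[of w] by simp
  \<comment> \<open>Symmetry is applied to the pair \<open>x\<close>, \<open>y\<close>: the terms
    with \<open>Re ev\<close> cancel, leaving \<open>Im ev\<close> times a positive number.\<close>
  have "x \<bullet> (Im ev \<cdot>\<^sub>v x + Re ev \<cdot>\<^sub>v y) = (Re ev \<cdot>\<^sub>v x - Im ev \<cdot>\<^sub>v y) \<bullet> y"
    using sym[OF x y] by (simp only: Ax Ay)
  then have "Im ev * (x \<bullet> x) + Re ev * (x \<bullet> y) = Re ev * (x \<bullet> y) - Im ev * (y \<bullet> y)"
    using x y by (simp add: scalar_prod_add_distrib[of _ n] minus_scalar_prod_distrib[of _ n])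
  then have "Im ev * (x \<bullet> x + y \<bullet> y) = 0" by (simp add: algebra_simps)
  moreover have "x \<bullet> x + y \<bullet> y > 0"
    using nz pos[OF x] pos[OF y] ge[OF x] ge[OF y] by (auto intro: add_pos_nonneg add_nonneg_pos)
  ultimately have im: "Im ev = 0" by simp
  have "A *\<^sub>v x = Re ev \<cdot>\<^sub>v x" "A *\<^sub>v y = Re ev \<cdot>\<^sub>v y"
    unfolding Ax Ay using im x y by (auto intro!: eq_vecI)
  then have "eigenvalue A (Re ev)"
    using nz x y A by (auto simp: eigenvalue_def eigenvector_def)
  then show ?thesis by (auto simp: spectrum_def)
qed

text \<open>An eigenvalue of the Gram matrix is the quotient of the squared norms of
  \<open>R *\<^sub>v v\<close> and \<open>v\<close> for an eigenvector \<open>v\<close>, hence lies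
  between \<open>c\<close> and \<open>C\<close>. Positivity of \<open>c\<close> also excludes the
  infinite value.\<close>

lemma cond_number_le:
  fixes R :: "real mat"
  assumes R: "R \<in> carrier_mat m n" and n: "n > 0" and c: "c > 0"
    and lower: "\<And>v. v \<in> carrier_vec n \<Longrightarrow> c * (v \<bullet> v) \<le> (R *\<^sub>v v) \<bullet> (R *\<^sub>v v)"
    and upper: "\<And>v. v \<in> carrier_vec n \<Longrightarrow> (R *\<^sub>v v) \<bullet> (R *\<^sub>v v) \<le> C * (v \<bullet> v)"
  shows "cond_number R \<le> ereal (sqrt (C / c))"
proof -
  define G where "G = transpose_mat R * R"
  have G: "G \<in> carrier_mat n n" using R by (simp add: G_def)
  have Gmul: "G *\<^sub>v v = transpose_mat R *\<^sub>v (R *\<^sub>v v)" if "v \<in> carrier_vec n" for v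
    unfolding G_def using R that by (intro assoc_mult_mat_vec) auto
  have quad: "x \<bullet> (G *\<^sub>v y) = (R *\<^sub>v x) \<bullet> (R *\<^sub>v y)"
    if "x \<in> carrier_vec n" "y \<in> carrier_vec n" for x y
  proof -
    have "(R *\<^sub>v x) \<bullet> (R *\<^sub>v y) = x \<bullet> (transpose_mat R *\<^sub>v (R *\<^sub>v y))"
    proof -
      have "(R *\<^sub>v x) \<bullet> (R *\<^sub>v y) = (R *\<^sub>v y) \<bullet> (R *\<^sub>v x)"
        using R that by (intro comm_scalar_prod[of _ m]) auto
      also have "\<dots> = (transpose_mat R *\<^sub>v (R *\<^sub>v y)) \<bullet> x"
        using R that by (intro transpose_vec_mult_scalar[symmetric]) auto
      also have "\<dots> = x \<bullet> (transpose_mat R *\<^sub>v (R *\<^sub>v y))"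
        using R that by (intro comm_scalar_prod[of _ n]) auto
      finally show ?thesis .
    qed
    then show ?thesis by (simp add: Gmul that)
  qed
  \<comment> \<open>\<open>Min\<close> and \<open>Max\<close> are elements of the spectrum only if
    it is finite and nonempty.\<close>
  have ne: "spectrum G \<noteq> {}"
  proof (rule real_symmetric_spectrum_nonempty[OF G n])
    fix x y :: "real vec" assume xy: "x \<in> carrier_vec n" "y \<in> carrier_vec n"
    then have "x \<bullet> (G *\<^sub>v y) = (R *\<^sub>v x) \<bullet> (R *\<^sub>v y)" by (rule quad)
    also have "\<dots> = (R *\<^sub>v y) \<bullet> (R *\<^sub>v x)" using R xy by (intro comm_scalar_prod[of _ m]) auto
    also have "\<dots> = y \<bullet> (G *\<^sub>v x)" using xy by (simp add: quad)
    also have "\<dots> = (G *\<^sub>v x) \<bullet> y" using G xy by (intro comm_scalar_prod[of _ n]) auto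
    finally show "x \<bullet> (G *\<^sub>v y) = (G *\<^sub>v x) \<bullet> y" .
  qed
  have fin: "finite (spectrum G)" by (rule card_finite_spectrum[OF G])
  have bounds: "c \<le> ev \<and> ev \<le> C" if ev: "ev \<in> spectrum G" for ev
  proof -
    obtain v where v: "v \<in> carrier_vec n" "v \<noteq> 0\<^sub>v n" "G *\<^sub>v v = ev \<cdot>\<^sub>v v"
      using ev G by (auto simp: spectrum_def eigenvalue_def eigenvector_def)
    have "v \<bullet> v > 0" using v conjugate_square_greater_0_vec[of v] by simp
    moreover have "(R *\<^sub>v v) \<bullet> (R *\<^sub>v v) = ev * (v \<bullet> v)"
      using quad[OF v(1) v(1)] v by simp
    ultimately show ?thesis using lower[OF v(1)] upper[OF v(1)] by simp
  qed
  have "lambda_min G \<in> spectrum G" "lambda_max G \<in> spectrum G"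
    using fin ne by (auto simp: lambda_min_def lambda_max_def)
  then have "c \<le> lambda_min G" "0 \<le> lambda_max G" "lambda_max G \<le> C"
    using bounds c by (auto intro: order_trans[OF less_imp_le])
  then show ?thesis using c
    by (auto simp: cond_number_def G_def[symmetric] Let_def intro!: frac_le)
qed


section \<open>Norm bounds for \<open>R\<close> and the final estimate\<close>

lemma scalar_prod_self_eq_sum:
  fixes v :: "real vec"
  assumes "v \<in> carrier_vec (Suc n)"
  shows "v \<bullet> v = (\<Sum>j\<le>n. (v $ j)\<^sup>2)"
  using assms by (simp add: scalar_prod_def atLeast0LessThan lessThan_Suc_atMost power2_eq_square)

theorem mainTheorem3:
  fixes \<beta> \<mu> h\<^sub>s h\<^sub>t :: real
    and n\<^sub>s n\<^sub>t :: nat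
    and s t :: "nat \<Rightarrow> real"
    and R :: "real mat"
    and q :: int
  assumes "\<beta> > 0" and "\<mu> > 0"
    and "n\<^sub>s \<ge> 1" and "n\<^sub>t \<ge> 1" and "n\<^sub>s \<ge> n\<^sub>t"
    and "h\<^sub>s = \<beta> / real n\<^sub>s"
    and "h\<^sub>t = 2 * \<mu> / real n\<^sub>t"
    and "\<And>i. i \<le> n\<^sub>s \<Longrightarrow> s i = h\<^sub>s * real i"
    and "\<And>j. j \<le> n\<^sub>t \<Longrightarrow> t j = - \<mu> + h\<^sub>t * real j"
    and "R = mat (n\<^sub>s + 1) (n\<^sub>t + 1) (\<lambda>(i, j). exp (- s i * t j))"
    and "q = \<lfloor>real (n\<^sub>s + 1) / real (n\<^sub>t + 1)\<rfloor>"
    and "1 \<le> n\<^sub>t + 1" and "real (n\<^sub>t + 1) \<le> \<beta> * \<mu> / (2 * exp 1)"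
  shows "cond_number R \<le>
    ereal (sqrt 2 * real (n\<^sub>t + 1) * exp (3 * \<beta> * \<mu>)
           * (1 + 1 / real_of_int q) powr (real n\<^sub>t + 1 / 2))"
proof -
  \<comment> \<open>The floor \<open>q\<close> as a natural number. It is positive because
    \<open>n\<^sub>s \<ge> n\<^sub>t\<close>, so \<open>1 / k\<close> is a genuine quotient.\<close>
  define k where "k = (n\<^sub>s + 1) div (n\<^sub>t + 1)"
  define b where "b = \<beta> * \<mu>"
  define K where "K = exp (2 * b) * (1 + 1 / real k) ^ n\<^sub>t"
  define C where "C = real (n\<^sub>s + 1) * real (n\<^sub>t + 1) * (exp b)\<^sup>2"
  have b: "b > 0" using assms(1,2) by (simp add: b_def)
  have qk: "q = int k" unfolding assms(11) k_def by (rule floor_divide_of_nat_eq)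
  have k0: "k > 0" using assms(5) by (simp add: k_def div_greater_zero_iff)
  have k1: "k * (n\<^sub>t + 1) \<le> n\<^sub>s + 1" by (simp add: k_def div_times_less_eq_dividend del: add_Suc_right mult_Suc_right)
  have k2: "n\<^sub>s + 1 \<le> (k + 1) * (n\<^sub>t + 1)"
    using dividend_less_div_times[of "n\<^sub>t + 1" "n\<^sub>s + 1"] by (simp add: k_def)
  have K: "K > 0" by (simp add: K_def add_pos_nonneg)
  have R: "R \<in> carrier_mat (Suc n\<^sub>s) (Suc n\<^sub>t)" by (simp add: assms(10))
  have entry: "R $$ (i, j) = exp (- (\<beta> / n\<^sub>s * i) * (- \<mu> + 2 * \<mu> / n\<^sub>t * j))"
    if "i \<le> n\<^sub>s" "j \<le> n\<^sub>t" for i j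
    using that assms(6-9) by (simp add: assms(10))
  have entry_le: "\<bar>R $$ (i, j)\<bar> \<le> exp b" if ij: "i \<le> n\<^sub>s" "j \<le> n\<^sub>t" for i j
  proof -
    \<comment> \<open>The exponent is minus the product of a row point in the interval from 0 to
      \<open>\<beta>\<close> and a column point at least \<open>- \<mu>\<close>.\<close>
    have "\<beta> / n\<^sub>s * i * (\<mu> - 2 * \<mu> / n\<^sub>t * j) \<le> \<beta> / n\<^sub>s * i * \<mu>"
      using assms(1,2) by (intro mult_left_mono) auto
    also have "\<dots> \<le> \<beta> * \<mu>"
      using assms(1-3) ij by (intro mult_right_mono) (auto simp: field_simps)
    finally show ?thesis by (simp add: entry[OF ij] b_def algebra_simps)
  qed
  have Rv: "(R *\<^sub>v v) $ i = (\<Sum>j\<le>n\<^sub>t. R $$ (i, j) * v $ j)"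
    if "v \<in> carrier_vec (Suc n\<^sub>t)" "i \<le> n\<^sub>s" for v i
    using that R by (simp add: scalar_prod_def atLeast0LessThan lessThan_Suc_atMost)
  have norm_R: "(R *\<^sub>v v) \<bullet> (R *\<^sub>v v) = (\<Sum>i\<le>n\<^sub>s. ((R *\<^sub>v v) $ i)\<^sup>2)"
    if "v \<in> carrier_vec (Suc n\<^sub>t)" for v
    using R that by (intro scalar_prod_self_eq_sum) auto
  \<comment> \<open>Each of the \<open>k\<close> disjoint residue classes contributes at least the
    squared norm of \<open>v\<close> divided by \<open>K\<^sup>2\<close>.\<close>
  have "cond_number R \<le> ereal (sqrt (C / (k / K\<^sup>2)))"
  proof (rule cond_number_le[OF R])
    show "0 < real k / K\<^sup>2" using k0 K by simp
    fix v :: "real vec" assume v: "v \<in> carrier_vec (Suc n\<^sub>t)"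
    have "k * (\<Sum>j\<le>n\<^sub>t. (v $ j)\<^sup>2) = (\<Sum>r<k. \<Sum>j\<le>n\<^sub>t. (v $ j)\<^sup>2)" by simp
    also have "\<dots> \<le> (\<Sum>r<k. K\<^sup>2 * (\<Sum>l\<le>n\<^sub>t. ((R *\<^sub>v v) $ (r + k * l))\<^sup>2))"
    proof (rule sum_mono)
      fix r assume r: "r \<in> {..<k}"
      \<comment> \<open>The selected rows exist: the largest index is below
        \<open>k * (n\<^sub>t + 1) \<le> n\<^sub>s + 1\<close>.\<close>
      have "r + k * l \<le> n\<^sub>s" if "l \<le> n\<^sub>t" for l
      proof -
        have "k * l \<le> k * n\<^sub>t" using that by simp
        moreover have "r < k" "k * n\<^sub>t + k \<le> n\<^sub>s + 1" using r k1 by auto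
        ultimately show ?thesis by linarith
      qed
      then have "(\<Sum>l\<le>n\<^sub>t. ((R *\<^sub>v v) $ (r + k * l))\<^sup>2) =
        (\<Sum>l\<le>n\<^sub>t. (\<Sum>j\<le>n\<^sub>t. exp (- (\<beta> / n\<^sub>s * real (r + k * l)) * (- \<mu> + 2 * \<mu> / n\<^sub>t * j)) * v $ j)\<^sup>2)"
        by (simp add: Rv[OF v] entry)
      then show "(\<Sum>j\<le>n\<^sub>t. (v $ j)\<^sup>2) \<le> K\<^sup>2 * (\<Sum>l\<le>n\<^sub>t. ((R *\<^sub>v v) $ (r + k * l))\<^sup>2)"
        using residue_class_lower_bound[OF assms(1,2,4,5) _ k1 k2 assms(13), of r "($) v"] r
        by (simp only: K_def b_def lessThan_iff)
    qed
    also have "\<dots> = K\<^sup>2 * (\<Sum>r<k. \<Sum>l\<le>n\<^sub>t. ((R *\<^sub>v v) $ (r + k * l))\<^sup>2)"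
      by (simp add: sum_distrib_left)
    also have "\<dots> \<le> K\<^sup>2 * (\<Sum>i<n\<^sub>s + 1. ((R *\<^sub>v v) $ i)\<^sup>2)"
      using k1 by (intro mult_left_mono sum_residue_classes_le) auto
    finally show "k / K\<^sup>2 * (v \<bullet> v) \<le> (R *\<^sub>v v) \<bullet> (R *\<^sub>v v)"
      using K by (simp add: norm_R[OF v] scalar_prod_self_eq_sum[OF v] lessThan_Suc_atMost field_simps)
    \<comment> \<open>Cauchy-Schwarz on a single row; summing over the \<open>n\<^sub>s + 1\<close>
      rows yields \<open>C\<close>.\<close>
    have "((R *\<^sub>v v) $ i)\<^sup>2 \<le> real (n\<^sub>t + 1) * (exp b)\<^sup>2 * (v \<bullet> v)" if i: "i \<le> n\<^sub>s" for i
    proof -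
      have "\<bar>(R *\<^sub>v v) $ i\<bar> \<le> (\<Sum>j\<le>n\<^sub>t. \<bar>R $$ (i, j)\<bar> * \<bar>v $ j\<bar>)"
        unfolding Rv[OF v i] by (auto simp: abs_mult intro!: order_trans[OF sum_abs])
      also have "\<dots> \<le> L2_set (\<lambda>j. exp b) {..n\<^sub>t} * L2_set (($) v) {..n\<^sub>t}"
      proof -
        have "(\<Sum>j\<le>n\<^sub>t. \<bar>R $$ (i, j)\<bar> * \<bar>v $ j\<bar>) \<le> (\<Sum>j\<le>n\<^sub>t. \<bar>exp b\<bar> * \<bar>v $ j\<bar>)"
          using entry_le[OF i] by (intro sum_mono mult_right_mono) simp_all
        also have "\<dots> \<le> L2_set (\<lambda>j. exp b) {..n\<^sub>t} * L2_set (($) v) {..n\<^sub>t}"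
          by (rule L2_set_mult_ineq)
        finally show ?thesis .
      qed
      finally have "\<bar>(R *\<^sub>v v) $ i\<bar>\<^sup>2 \<le> (L2_set (\<lambda>j. exp b) {..n\<^sub>t} * L2_set (($) v) {..n\<^sub>t})\<^sup>2"
        by (intro power_mono) auto
      then show ?thesis
        by (simp add: L2_set_def power_mult_distrib sum_nonneg scalar_prod_self_eq_sum[OF v])
    qed
    then have "(\<Sum>i\<le>n\<^sub>s. ((R *\<^sub>v v) $ i)\<^sup>2) \<le> (\<Sum>i\<le>n\<^sub>s. real (n\<^sub>t + 1) * (exp b)\<^sup>2 * (v \<bullet> v))"
      by (intro sum_mono) auto
    then show "(R *\<^sub>v v) \<bullet> (R *\<^sub>v v) \<le> C * (v \<bullet> v)"
      by (simp add: norm_R[OF v] C_def mult.assoc)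
  qed simp
  also have "sqrt (C / (k / K\<^sup>2)) \<le> sqrt 2 * real (n\<^sub>t + 1) * exp (3 * \<beta> * \<mu>)
           * (1 + 1 / real_of_int q) powr (real n\<^sub>t + 1 / 2)"
  proof -
    \<comment> \<open>After the square root, the factor \<open>1 + 1 / k\<close> provides the extra
      \<open>1 / 2\<close> in the exponent, and \<open>n\<^sub>t + 1\<close> joins the one from
      Cauchy-Schwarz.\<close>
    have k3: "real (n\<^sub>s + 1) / k \<le> (1 + 1 / k) * (n\<^sub>t + 1)"
    proof -
      have "real (n\<^sub>s + 1) / k \<le> real ((k + 1) * (n\<^sub>t + 1)) / k"
        using k2 by (intro divide_right_mono of_nat_mono) auto
      then show ?thesis using k0 by (simp add: field_simps)
    qed
    have "C / (k / K\<^sup>2) = real (n\<^sub>s + 1) / k * (n\<^sub>t + 1) * (exp b * K)\<^sup>2"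
      by (simp add: C_def power_mult_distrib)
    also have "\<dots> \<le> (1 + 1 / k) * (n\<^sub>t + 1) * (n\<^sub>t + 1) * (exp b * K)\<^sup>2"
      by (intro mult_right_mono k3) auto
    also have "\<dots> = (1 + 1 / k) * ((n\<^sub>t + 1) * (exp b * K))\<^sup>2"
      by (simp add: power2_eq_square)
    finally have "sqrt (C / (k / K\<^sup>2)) \<le> sqrt ((1 + 1 / k) * ((n\<^sub>t + 1) * (exp b * K))\<^sup>2)"
      by simp
    also have "\<dots> = real (n\<^sub>t + 1) * (exp b * exp (2 * b)) * (sqrt (1 + 1 / k) * (1 + 1 / k) ^ n\<^sub>t)"
      using K by (simp add: real_sqrt_mult K_def abs_mult)
    also have "exp b * exp (2 * b) = exp (3 * \<beta> * \<mu>)"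
      by (simp add: b_def exp_add[symmetric])
    also have "sqrt (1 + 1 / k) * (1 + 1 / k) ^ n\<^sub>t = (1 + 1 / real_of_int q) powr (real n\<^sub>t + 1 / 2)"
    proof -
      have "1 + 1 / real k > 0" by (simp add: add_pos_nonneg)
      then show ?thesis by (simp add: qk powr_add powr_half_sqrt powr_realpow)
    qed
    \<comment> \<open>The leading constant is now 1, to be compared with
      \<open>sqrt 2\<close>.\<close>
    finally have *: "sqrt (C / (k / K\<^sup>2)) \<le> 1 * (real (n\<^sub>t + 1) * exp (3 * \<beta> * \<mu>)
           * (1 + 1 / real_of_int q) powr (real n\<^sub>t + 1 / 2))" by simp
    also have "\<dots> \<le> sqrt 2 * (real (n\<^sub>t + 1) * exp (3 * \<beta> * \<mu>)
           * (1 + 1 / real_of_int q) powr (real n\<^sub>t + 1 / 2))"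
      by (intro mult_right_mono) auto
    finally show ?thesis by (simp add: mult.assoc)
  qed
  finally show ?thesis by simp
qed

end
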